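(* Let $G=(V,E)$ be a locally finite graph with positive edge weights satisfying $w_{xy}=w_{yx}$ for all $y\sim x\in V$, and with measure satisfying $\mu(x)\ge\mu_{\min}>0$ for all $x\in V$, where $\mu_{\min}$ is a constant. Let $h:V\to\mathbb{R}$ be a function such that (i) there exists a constant $h_0>0$ with $h(x)\ge h_0$ for all $x\in V$; (ii) $1/h\in L^1(V)$. Let $f:V\times\mathbb{R}\to\mathbb{R}$ satisfy, with $F(x,s)=\int_0^s f(x,t)\,dt$: (a) $f(x,s)$ is continuous in $s$, $f(x,0)=0$ for all $x\in V$, and for every $M>0$ there exists a constant $A_M$ such that $\max_{s\in[0,M]}f(x,s)\le A_M$ for all $x\in V$; (b) there exists a constant $\theta>2$ such that $0<\theta F(x,s)\le s f(x,s)$ for all $x\in V$ and $s>0$; (c) for all $x\in V$, $\limsup_{s\to0+}\frac{2F(x,s)}{s^2}<\lambda_1$, where $\lambda_1=\inf_{\int_V u^2d\mu=1}\int_V(|\nabla u|^2+hu^2)\,d\mu$. Then the equation $-\Delta u+hu=f(x,u)$ has a strictly positive solution, i.e. there is $u:V\to\mathbb{R}$ with $u(x)>0$ and $-\Delta u(x)+h(x)u(x)=f(x,u(x))$ for all $x\in V$.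
   Context: $G=(V,E)$ is a graph with vertex set $V$ and edge set $E$; $y\sim x$ means $xy\in E$. Locally finite means each $x\in V$ has only finitely many $y$ with $xy\in E$. Each edge $xy$ carries a weight $w_{xy}>0$. The measure is a function $\mu:V\to(0,\infty)$, and $\int_V g\,d\mu=\sum_{x\in V}\mu(x)g(x)$; $L^q(V)$ is taken with respect to $\mu$. The Laplacian is $\Delta u(x)=\frac{1}{\mu(x)}\sum_{y\sim x}w_{xy}(u(y)-u(x))$, and $|\nabla u|(x)=\left(\frac{1}{2\mu(x)}\sum_{y\sim x}w_{xy}(u(y)-u(x))^2\right)^{1/2}$. $C_c(V)$ is the set of finitely supported functions on $V$; $W^{1,2}(V)$ is the completion of $C_c(V)$ under $\|u\|_{W^{1,2}(V)}=\left(\int_V(|\nabla u|^2+u^2)d\mu\right)^{1/2}$ (regarded as a space of functions on $V$). $\mathscr{H}=\{u\in W^{1,2}(V):\int_V hu^2d\mu<+\infty\}$; the infimum defining $\lambda_1$ is over $u\in\mathscr{H}$ with $\int_Vu^2d\mu=1$. *)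

theory Defs
  imports "HOL-Analysis.Analysis"
begin

text \<open>
  The vertex set of a graph is a whole type, the edge set a set of unordered pairs
  \<open>{x, y}\<close>. Weights \<open>w x y\<close> only matter when \<open>{x, y}\<close> is an edge; a loop \<open>{x, x}\<close>
  contributes nothing to any of the notions below.
\<close>

definition neighbours :: "'v set set \<Rightarrow> 'v \<Rightarrow> 'v set" where
  "neighbours E x = {y. {x, y} \<in> E}"

definition is_graph :: "'v set set \<Rightarrow> bool" where
  "is_graph E \<longleftrightarrow> (\<forall>e\<in>E. \<exists>x y. e = {x, y})"

definition locally_finite :: "'v set set \<Rightarrow> bool" where
  "locally_finite E \<longleftrightarrow> (\<forall>x. finite (neighbours E x))"

definition vertex_measure :: "('v \<Rightarrow> real) \<Rightarrow> 'v measure" where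
  "vertex_measure \<mu> = point_measure UNIV (\<lambda>x. ennreal (\<mu> x))"

definition laplacian ::
  "'v set set \<Rightarrow> ('v \<Rightarrow> 'v \<Rightarrow> real) \<Rightarrow> ('v \<Rightarrow> real) \<Rightarrow> ('v \<Rightarrow> real) \<Rightarrow> 'v \<Rightarrow> real" where
  "laplacian E w \<mu> u x = 1 / \<mu> x * (\<Sum>y\<in>neighbours E x. w x y * (u y - u x))"

definition grad_norm ::
  "'v set set \<Rightarrow> ('v \<Rightarrow> 'v \<Rightarrow> real) \<Rightarrow> ('v \<Rightarrow> real) \<Rightarrow> ('v \<Rightarrow> real) \<Rightarrow> 'v \<Rightarrow> real" where
  "grad_norm E w \<mu> u x =
     sqrt (1 / (2 * \<mu> x) * (\<Sum>y\<in>neighbours E x. w x y * (u y - u x)\<^sup>2))"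

definition finitely_supported :: "('v \<Rightarrow> real) set" where
  "finitely_supported = {u. finite {x. u x \<noteq> 0}}"

definition W12_norm ::
  "'v set set \<Rightarrow> ('v \<Rightarrow> 'v \<Rightarrow> real) \<Rightarrow> ('v \<Rightarrow> real) \<Rightarrow> ('v \<Rightarrow> real) \<Rightarrow> real" where
  "W12_norm E w \<mu> u =
     sqrt (LINT x|vertex_measure \<mu>. (grad_norm E w \<mu> u x)\<^sup>2 + (u x)\<^sup>2)"

text \<open>
  The completion of the finitely supported functions, as a space of functions: the class of a
  Cauchy sequence is identified with its pointwise limit. The limit exists because
  \<open>\<mu> x * (u x)\<^sup>2 \<le> (W12_norm E w \<mu> u)\<^sup>2\<close>, and it determines the class by Fatou's lemma.
  The norm is only applied to finitely supported functions, for which the integrand is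
  finitely supported (on a locally finite graph) and hence integrable.
\<close>

definition W12 ::
  "'v set set \<Rightarrow> ('v \<Rightarrow> 'v \<Rightarrow> real) \<Rightarrow> ('v \<Rightarrow> real) \<Rightarrow> ('v \<Rightarrow> real) set" where
  "W12 E w \<mu> = {u. \<exists>\<phi> :: nat \<Rightarrow> 'v \<Rightarrow> real.
     (\<forall>n. \<phi> n \<in> finitely_supported) \<and>
     (\<forall>e>0. \<exists>N. \<forall>m\<ge>N. \<forall>n\<ge>N. W12_norm E w \<mu> (\<lambda>x. \<phi> m x - \<phi> n x) < e) \<and>
     (\<forall>x. (\<lambda>n. \<phi> n x) \<longlonglongrightarrow> u x)}"

definition H_space ::
  "'v set set \<Rightarrow> ('v \<Rightarrow> 'v \<Rightarrow> real) \<Rightarrow> ('v \<Rightarrow> real) \<Rightarrow> ('v \<Rightarrow> real) \<Rightarrow> ('v \<Rightarrow> real) set" where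
  "H_space E w \<mu> h =
     {u \<in> W12 E w \<mu>. integrable (vertex_measure \<mu>) (\<lambda>x. h x * (u x)\<^sup>2)}"

text \<open>
  For \<open>h\<close> and \<open>\<mu>\<close> bounded below by positive constants and positive weights on a locally finite
  graph, the set below is nonempty (it contains a multiple of each indicator of a vertex) and
  bounded below, so \<open>Inf\<close> is the actual infimum; all integrands are integrable.
\<close>

definition lambda1 ::
  "'v set set \<Rightarrow> ('v \<Rightarrow> 'v \<Rightarrow> real) \<Rightarrow> ('v \<Rightarrow> real) \<Rightarrow> ('v \<Rightarrow> real) \<Rightarrow> real" where
  "lambda1 E w \<mu> h =
     Inf ((\<lambda>u. LINT x|vertex_measure \<mu>. (grad_norm E w \<mu> u x)\<^sup>2 + h x * (u x)\<^sup>2) `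
          {u \<in> H_space E w \<mu> h. (LINT x|vertex_measure \<mu>. (u x)\<^sup>2) = 1})"

definition primitive :: "('v \<Rightarrow> real \<Rightarrow> real) \<Rightarrow> 'v \<Rightarrow> real \<Rightarrow> real" where
  "primitive f x s = (LBINT t=ereal 0..ereal s. f x t)"

end

theory Submission
  imports Defs
begin

text \<open>
  On a finite set of vertices with zero boundary values, a mountain pass argument within the
  cone of nonnegative functions gives a critical point whose level lies between two positive
  bounds that do not depend on the finite set. Since \<open>\<theta> > 2\<close>, these bounds control the energy from both
  sides, hence the solutions are uniformly bounded, and \<open>1/h \<in> L\<^sup>1\<close> makes
  \<open>\<integral> f(x, u) u d\<mu>\<close> uniformly small outside a fixed finite set. So a cluster point of these
  solutions (for pointwise convergence, along the finite subsets of a connected component) solves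
  the equation and is not zero; the strong maximum principle makes it positive, and the solutions
  on the components are glued together. The lower bound on the level comes from \<open>F(x, s) \<le> C s\<^sup>\<theta>\<close>
  for \<open>s \<le> 1\<close>, uniformly in \<open>x\<close>, because \<open>F(x, s) / s\<^sup>\<theta>\<close> is nondecreasing in \<open>s\<close>.
\<close>

subsection \<open>A mountain pass in the nonnegative cone\<close>

lemma continuous_on_minus_scaled:
  fixes g :: "('v \<Rightarrow> real) \<Rightarrow> 'v \<Rightarrow> real"
  assumes "continuous_on UNIV c" "\<And>x. continuous_on UNIV (\<lambda>u. g u x)"
  shows "continuous_on UNIV (\<lambda>u x. u x - c u * g u x)"
  by (intro continuous_on_coordinatewise_then_product continuous_intros assms
      continuous_on_product_coordinates)

text \<open>This is Tychonoff's theorem for the product topology on functions, that is, for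
  pointwise convergence. It gives compactness both in the mountain pass and for the family of
  solutions on finite sets.\<close>

lemma compact_positive_box:
  "compact {u :: 'v \<Rightarrow> real. \<forall>x. 0 \<le> u x \<and> u x \<le> c x}"
proof -
  have "compact (PiE UNIV (\<lambda>x. {0..c x}))"
    using compactin_PiE[of "\<lambda>_. euclidean :: real topology" UNIV "\<lambda>x. {0..c x}"]
    by (simp add: euclidean_product_topology)
  also have "PiE UNIV (\<lambda>x. {0..c x}) = {u. \<forall>x. 0 \<le> u x \<and> u x \<le> c x}"
    by (auto simp: PiE_def Pi_def)
  finally show ?thesis .
qed

text \<open>If there were no critical point, then one explicit Euler step with a fixed step size would
  lower \<open>J\<close> by a fixed amount on the part of a path where \<open>\<alpha> \<le> J\<close>, without moving the end points
  of the path; iterating it pushes the whole path below the pass.\<close>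

definition nonneg_supported :: "'v set \<Rightarrow> ('v \<Rightarrow> real) set" where
  "nonneg_supported \<Omega> = {u. \<forall>x. 0 \<le> u x \<and> (x \<notin> \<Omega> \<longrightarrow> u x = 0)}"

text \<open>Here \<open>g\<close> is the gradient of \<open>J\<close>, \<open>inv\<close> keeps
  explicit Euler steps in the cone, and the level set \<open>N = r\<close> is the ridge between 0
  and \<open>e\<close>: every path joining them crosses it.\<close>

lemma mountain_pass_cone:
  fixes J N :: "('v \<Rightarrow> real) \<Rightarrow> real" and g :: "('v \<Rightarrow> real) \<Rightarrow> 'v \<Rightarrow> real"
  assumes fin: "finite \<Omega>" and contJ: "continuous_on UNIV J" and contg: "\<And>x. continuous_on UNIV (\<lambda>u. g u x)"
    and contN: "continuous_on UNIV N"
    and g_off: "\<And>u x. x \<notin> \<Omega> \<Longrightarrow> g u x = 0"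
    and deriv: "\<And>u v t. ((\<lambda>\<tau>. J (\<lambda>x. u x - \<tau> * v x)) has_real_derivative
        - (\<Sum>x\<in>\<Omega>. g (\<lambda>x. u x - t * v x) x * v x)) (at t)"
    and inv: "T > 0" "\<And>u s. u \<in> nonneg_supported \<Omega> \<Longrightarrow> 0 \<le> s \<Longrightarrow> s \<le> T \<Longrightarrow> (\<lambda>x. u x - s * g u x) \<in> nonneg_supported \<Omega>"
    and bdd: "\<And>u x. u \<in> nonneg_supported \<Omega> \<Longrightarrow> J u \<ge> 0 \<Longrightarrow> u x \<le> R"
    and \<alpha>: "\<alpha> > 0" "\<And>u. u \<in> nonneg_supported \<Omega> \<Longrightarrow> N u = r \<Longrightarrow> J u \<ge> \<alpha>"
    and zero: "J (\<lambda>x. 0) \<le> 0" "N (\<lambda>x. 0) \<le> r"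
    and e: "e \<in> nonneg_supported \<Omega>" "N e \<ge> r" "J e \<le> 0"
    and \<beta>: "\<And>s. 0 \<le> s \<Longrightarrow> s \<le> 1 \<Longrightarrow> J (\<lambda>x. s * e x) \<le> \<beta>"
  shows "\<exists>u \<in> nonneg_supported \<Omega>. (\<forall>x\<in>\<Omega>. g u x = 0) \<and> \<alpha> / 2 \<le> J u \<and> J u \<le> \<beta>"
proof (rule ccontr)
  assume no: "\<not> ?thesis"
  define K where "K = {u \<in> nonneg_supported \<Omega>. \<alpha> / 2 \<le> J u \<and> J u \<le> \<beta>}"
  define box where "box = {u :: 'v \<Rightarrow> real. \<forall>x. 0 \<le> u x \<and> u x \<le> (if x \<in> \<Omega> then R else 0)}"
  \<comment> \<open>\<open>bdd\<close> applies because \<open>\<alpha> / 2\<close> is positive, so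
    \<open>K\<close> is a closed part of a compact box.\<close>
  have "K = box \<inter> {u. \<alpha> / 2 \<le> J u \<and> J u \<le> \<beta>}"
  proof
    show "K \<subseteq> box \<inter> {u. \<alpha> / 2 \<le> J u \<and> J u \<le> \<beta>}"
      using bdd \<alpha>(1) unfolding K_def box_def nonneg_supported_def by force
    show "box \<inter> {u. \<alpha> / 2 \<le> J u \<and> J u \<le> \<beta>} \<subseteq> K"
      unfolding K_def box_def nonneg_supported_def
      by auto (metis order_antisym)
  qed
  moreover have "closed {u. \<alpha> / 2 \<le> J u \<and> J u \<le> \<beta>}"
    by (intro closed_Collect_conj closed_Collect_le contJ continuous_on_const)
  moreover have "compact box" unfolding box_def by (rule compact_positive_box)
  ultimately have "compact K" by auto
  define \<psi> where "\<psi> u = (\<Sum>x\<in>\<Omega>. g u x * g u x)" for u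
  \<comment> \<open>The derivative of \<open>J\<close> along the Euler line from \<open>u\<close> at
    time \<open>\<tau>\<close> is \<open>- \<phi> (\<tau>, u)\<close>; at time 0 it is
    \<open>- \<psi> u\<close>.\<close>
  define \<phi> where "\<phi> p = (\<Sum>x\<in>\<Omega>. g (\<lambda>x. snd p x - fst p * g (snd p) x) x * g (snd p) x)"
    for p :: "real \<times> ('v \<Rightarrow> real)"
  have contg': "continuous_on S (\<lambda>p. g (G p) x)"
    if "continuous_on S G" for S x and G :: "'a::topological_space \<Rightarrow> 'v \<Rightarrow> real"
    using continuous_on_compose2[OF contg that] by auto
  have cont_coord: "continuous_on S (\<lambda>p. G p x)"
    if "continuous_on S G" for S x and G :: "'a::topological_space \<Rightarrow> 'v \<Rightarrow> real"
    using continuous_on_compose2[OF continuous_on_product_coordinates that] by auto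
  have cont\<phi>: "continuous_on S \<phi>" for S
    unfolding \<phi>_def
    by (intro continuous_intros contg' continuous_on_coordinatewise_then_product cont_coord)
  have fin_pos: "\<psi> u > 0" if u: "u \<in> K" for u
  proof -
    from no u obtain x where x: "x \<in> \<Omega>" "g u x \<noteq> 0" unfolding K_def by auto
    then show ?thesis unfolding \<psi>_def using fin
      by (intro sum_pos2[of _ x]) (auto simp: zero_less_mult_iff)
  qed
  obtain \<delta> where \<delta>: "\<delta> > 0" "\<And>u. u \<in> K \<Longrightarrow> \<delta> \<le> \<psi> u"
  proof (cases "K = {}")
    case True
    then show ?thesis using that[of 1] by auto
  next
    case False
    have "continuous_on K \<psi>" unfolding \<psi>_def
      by (intro continuous_intros contg')
    from continuous_attains_inf[OF \<open>compact K\<close> False this] fin_pos that show ?thesis by blast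
  qed
  \<comment> \<open>\<open>Z\<close> collects the pairs at which the descent is too slow. Its
    projection to the time axis is compact and misses 0, which gives one step size for all of
    \<open>K\<close> from continuity of \<open>g\<close> alone.\<close>
  define Z where "Z = {p \<in> {0..T} \<times> K. \<phi> p \<le> \<delta> / 2}"
  have "Z = ({0..T} \<times> K) \<inter> {p. \<phi> p \<le> \<delta> / 2}" unfolding Z_def by auto
  moreover have "closed {p. \<phi> p \<le> \<delta> / 2}"
    by (intro closed_Collect_le cont\<phi> continuous_on_const)
  ultimately have "compact Z" using \<open>compact K\<close> by (auto intro!: compact_Int_closed compact_Times)
  then have "closed (fst ` Z)"
    by (intro compact_imp_closed compact_continuous_image continuous_intros)
  moreover have "0 \<notin> fst ` Z"
  proof
    assume "0 \<in> fst ` Z"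
    then obtain u where "u \<in> K" "\<phi> (0, u) \<le> \<delta> / 2" unfolding Z_def by auto
    moreover have "\<phi> (0, u) = \<psi> u" unfolding \<phi>_def \<psi>_def by simp
    ultimately show False using \<delta> by force
  qed
  ultimately obtain \<epsilon> where \<epsilon>: "\<epsilon> > 0" "\<And>\<tau>. \<tau> \<in> fst ` Z \<Longrightarrow> \<epsilon> \<le> dist 0 \<tau>"
    using separate_point_closed by metis
  define t where "t = min T (\<epsilon> / 2)"
  have t: "t > 0" "t \<le> T" "t < \<epsilon>" using inv(1) \<epsilon>(1) unfolding t_def by auto
  have \<phi>_ge: "\<phi> (\<tau>, u) > \<delta> / 2" if "0 \<le> \<tau>" "\<tau> \<le> t" "u \<in> K" for \<tau> u
  proof (rule ccontr)
    assume "\<not> ?thesis"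
    then have "(\<tau>, u) \<in> Z" using that t unfolding Z_def by auto
    then have "\<tau> \<in> fst ` Z" by force
    from \<epsilon>(2)[OF this] that t show False by auto
  qed
  \<comment> \<open>\<open>cut\<close> is 0 where \<open>J u \<le> \<alpha> / 2\<close> and 1 where
    \<open>J u \<ge> \<alpha>\<close>. It keeps \<open>\<Phi>\<close> continuous, fixes the end
    points of the path and allows full steps from level \<open>\<alpha>\<close> upwards.\<close>
  define cut where "cut u = min 1 (max 0 (2 * J u / \<alpha> - 1))" for u
  define \<Phi> where "\<Phi> u = (\<lambda>x. u x - (t * cut u) * g u x)" for u
  have cut01: "0 \<le> cut u" "cut u \<le> 1" for u unfolding cut_def by auto
  have cont\<Phi>: "continuous_on UNIV \<Phi>"
    unfolding \<Phi>_def cut_def using \<alpha>(1)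
    by (intro continuous_on_minus_scaled contg continuous_intros contJ) auto
  have \<Phi>_mem: "\<Phi> u \<in> nonneg_supported \<Omega>" if "u \<in> nonneg_supported \<Omega>" for u
    unfolding \<Phi>_def
  proof (rule inv(2)[OF that])
    show "t * cut u \<le> T" using cut01[of u] t mult_left_le[of "cut u" t] by linarith
  qed (use cut01 t in auto)
  have \<Phi>_id: "\<Phi> u = u" if "J u \<le> \<alpha> / 2" for u
  proof -
    have "2 * J u / \<alpha> \<le> 1" using that \<alpha>(1) by (simp add: field_simps)
    then show ?thesis unfolding \<Phi>_def cut_def by (simp add: max_def)
  qed
  have \<Phi>_dec: "J (\<Phi> u) \<le> J u - t * cut u * (\<delta> / 2)" if u: "u \<in> nonneg_supported \<Omega>" "J u \<le> \<beta>" for u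
  proof (cases "J u \<le> \<alpha> / 2")
    case True
    then have "2 * J u / \<alpha> \<le> 1" using \<alpha>(1) by (simp add: field_simps)
    then have "cut u = 0" unfolding cut_def by auto
    then show ?thesis using \<Phi>_id[OF True] by simp
  next
    case False
    then have uK: "u \<in> K" using u unfolding K_def by auto
    define s where "s = t * cut u"
    have s: "0 \<le> s" "s \<le> t" using cut01[of u] t unfolding s_def by (auto simp: mult_left_le)
    show ?thesis
    proof (cases "s = 0")
      case True
      then have "\<Phi> u = u" unfolding \<Phi>_def s_def[symmetric] by auto
      with True show ?thesis unfolding s_def[symmetric] by auto
    next
      case False
      with s have s0: "0 < s" by simp
      have D: "((\<lambda>\<tau>. J (\<lambda>x. u x - \<tau> * g u x)) has_real_derivative - \<phi> (\<tau>, u)) (at \<tau>)" for \<tau>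
        using deriv[of u "g u" \<tau>] unfolding \<phi>_def by simp
      obtain \<xi> where \<xi>: "0 < \<xi>" "\<xi> < s" and
        "J (\<lambda>x. u x - s * g u x) - J (\<lambda>x. u x - 0 * g u x) = (s - 0) * - \<phi> (\<xi>, u)"
        using MVT2[OF s0 D] by blast
      then have "J (\<Phi> u) = J u - s * \<phi> (\<xi>, u)" unfolding \<Phi>_def s_def by simp
      also have "\<dots> \<le> J u - s * (\<delta> / 2)"
        using \<phi>_ge[of \<xi> u] \<xi> s uK s0 by simp
      finally show ?thesis unfolding s_def .
    qed
  qed
  \<comment> \<open>As \<open>J\<close> does not increase along the iteration, a point whose level
    is still at least \<open>\<alpha>\<close> after \<open>n\<close> steps had such a level before
    each of them, so all of them were full steps.\<close>
  have iter: "(\<Phi> ^^ n) u \<in> nonneg_supported \<Omega> \<and> J ((\<Phi> ^^ n) u) \<le> J u \<and>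
      (J ((\<Phi> ^^ n) u) \<ge> \<alpha> \<longrightarrow> J ((\<Phi> ^^ n) u) \<le> J u - n * (t * \<delta> / 2))"
    if u: "u \<in> nonneg_supported \<Omega>" "J u \<le> \<beta>" for n u
  proof (induction n)
    case (Suc n)
    let ?v = "(\<Phi> ^^ n) u"
    have v: "?v \<in> nonneg_supported \<Omega>" "J ?v \<le> \<beta>" using Suc u by auto
    have nn: "0 \<le> t * cut ?v * (\<delta> / 2)" using t \<delta> cut01[of ?v] by simp
    have dec: "J (\<Phi> ?v) \<le> J ?v - t * cut ?v * (\<delta> / 2)" by (rule \<Phi>_dec[OF v])
    have "J (\<Phi> ?v) \<le> J u - Suc n * (t * \<delta> / 2)" if "J (\<Phi> ?v) \<ge> \<alpha>"
    proof -
      have ge: "J ?v \<ge> \<alpha>" using that dec nn by linarith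
      then have "2 * J ?v / \<alpha> \<ge> 2" using \<alpha>(1) by (simp add: field_simps)
      then have "cut ?v = 1" unfolding cut_def by auto
      with dec have "J (\<Phi> ?v) \<le> J ?v - t * \<delta> / 2" by simp
      moreover have "J ?v \<le> J u - n * (t * \<delta> / 2)" using Suc ge by blast
      moreover have "Suc n * (t * \<delta> / 2) = n * (t * \<delta> / 2) + t * \<delta> / 2"
        by (simp add: field_simps)
      ultimately show ?thesis by linarith
    qed
    then show ?case using Suc dec nn \<Phi>_mem[OF v(1)] by simp
  qed (use u in auto)
  obtain n :: nat where n: "real n * (t * \<delta> / 2) > \<beta> - \<alpha>"
    using ex_less_of_nat_mult[of "t * \<delta> / 2" "\<beta> - \<alpha>"] t \<delta> by auto
  have seg: "(\<lambda>x. s * e x) \<in> nonneg_supported \<Omega>" if "0 \<le> s" for s using e(1) that unfolding nonneg_supported_def by auto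
  have fixed: "(\<Phi> ^^ n) u = u" if "J u \<le> 0" for u
    by (induction n) (use \<Phi>_id[of u] that \<alpha>(1) in auto)
  have cont_iter: "continuous_on UNIV (\<Phi> ^^ n)"
  proof (induction n)
    case (Suc n)
    then show ?case using continuous_on_compose2[OF cont\<Phi> Suc] by (simp add: o_def)
  qed (auto simp: id_def)
  \<comment> \<open>The deformed path still joins 0 to \<open>e\<close>, so it meets
    \<open>N = r\<close>. There \<open>J\<close> is at least \<open>\<alpha>\<close>, whereas
    \<open>n\<close> full steps would have brought it below \<open>\<alpha>\<close>.\<close>
  define \<gamma> where "\<gamma> s = (\<Phi> ^^ n) (\<lambda>x. s * e x)" for s
  have "continuous_on UNIV \<gamma>"
    unfolding \<gamma>_def
    by (rule continuous_on_compose2[OF cont_iter])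
      (auto intro!: continuous_on_coordinatewise_then_product continuous_intros)
  then have "continuous_on {0..1} (\<lambda>s. N (\<gamma> s))"
    by (intro continuous_on_compose2[OF contN]) (auto intro: continuous_on_subset)
  moreover have "N (\<gamma> 0) \<le> r" "r \<le> N (\<gamma> 1)"
    using fixed[OF zero(1)] fixed[OF e(3)] zero e unfolding \<gamma>_def by auto
  ultimately obtain s where s: "0 \<le> s" "s \<le> 1" "N (\<gamma> s) = r"
    using IVT'[of "\<lambda>s. N (\<gamma> s)" 0 r 1] by auto
  have "\<gamma> s \<in> nonneg_supported \<Omega>" using iter[OF seg \<beta>] s unfolding \<gamma>_def by blast
  then have "J (\<gamma> s) \<ge> \<alpha>" using \<alpha>(2) s by blast
  moreover from this have "J (\<gamma> s) \<le> J (\<lambda>x. s * e x) - n * (t * \<delta> / 2)"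
    using iter[OF seg \<beta>, of s n] s unfolding \<gamma>_def by blast
  ultimately show False using \<beta>[of s] s n by linarith
qed

subsection \<open>Growth, cluster points and summability\<close>

text \<open>\<open>AR\<close> makes the derivative of \<open>F s * s powr (-\<theta>)\<close>
  nonnegative; the conclusion is this monotonicity cleared of denominators.\<close>

lemma superhomogeneous_growth:
  fixes F f :: "real \<Rightarrow> real"
  assumes der: "\<And>s. s > 0 \<Longrightarrow> (F has_real_derivative f s) (at s)"
    and AR: "\<And>s. s > 0 \<Longrightarrow> \<theta> * F s \<le> s * f s"
    and st: "0 < s" "s \<le> t"
  shows "F s * t powr \<theta> \<le> F t * s powr \<theta>"
proof -
  have "F s * s powr (-\<theta>) \<le> F t * t powr (-\<theta>)"
  proof (rule DERIV_nonneg_imp_nondecreasing[OF st(2)], intro exI conjI)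
    fix r assume r: "s \<le> r" "r \<le> t"
    then have r0: "r > 0" using st by simp
    show "((\<lambda>r. F r * r powr (-\<theta>)) has_real_derivative
        f r * r powr (-\<theta>) + (-\<theta> * r powr (-\<theta> - 1)) * F r) (at r)"
      using r0 by (auto intro!: derivative_eq_intros der)
    have "f r * r powr (-\<theta>) + (-\<theta> * r powr (-\<theta> - 1)) * F r = r powr (-\<theta> - 1) * (r * f r - \<theta> * F r)"
      using r0 by (simp add: powr_diff field_simps)
    then show "0 \<le> f r * r powr (-\<theta>) + (-\<theta> * r powr (-\<theta> - 1)) * F r"
      using AR[OF r0] by simp
  qed
  then show ?thesis using st by (simp add: powr_minus field_simps)
qed

text \<open>The first assumption says that \<open>u\<close> is a cluster point of \<open>F\<close>.
  Filters take the place of subsequences in the passage to the limit.\<close>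

lemma cluster_point_in_closed:
  assumes "inf (nhds u) F \<noteq> bot" "closed S" "eventually (\<lambda>x. x \<in> S) F"
  shows "u \<in> S"
proof (rule ccontr)
  assume "u \<notin> S"
  then have "eventually (\<lambda>x. x \<in> - S) (nhds u)"
    using assms(2) by (intro eventually_nhds_in_open) auto
  with assms(3) have "eventually (\<lambda>x. False) (inf (nhds u) F)"
    unfolding eventually_inf by blast
  with assms(1) show False by (simp add: trivial_limit_def)
qed

section \<open>Sums against the vertex measure and their tails\<close>

text \<open>Multiplying \<open>g\<close> by the indicator of \<open>B\<close> leaves an integrand
  with finite support, whose integral for the point measure is the finite sum.\<close>

lemma sum_vertex_measure_le:
  assumes int: "integrable (vertex_measure \<mu>) g" and g: "\<And>x. g x > 0" and \<mu>: "\<And>x. \<mu> x > 0"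
    and B: "finite B"
  shows "(\<Sum>x\<in>B. \<mu> x * g x) \<le> enn2real (\<integral>\<^sup>+x. ennreal (g x) \<partial>vertex_measure \<mu>)"
proof -
  have fin: "finite {a \<in> UNIV. 0 < ennreal (\<mu> a) \<and> 0 < ennreal (g a) * indicator B a}"
    by (rule finite_subset[OF _ B]) (auto simp: indicator_def split: if_splits)
  have "ennreal (\<Sum>x\<in>B. \<mu> x * g x) = (\<Sum>x\<in>B. ennreal (\<mu> x) * (ennreal (g x) * indicator B x))"
    using g \<mu> by (subst sum_ennreal[symmetric])
      (auto simp: ennreal_mult less_imp_le intro!: sum.cong)
  also have "\<dots> = (\<Sum>x | x \<in> UNIV \<and> 0 < ennreal (\<mu> x) \<and> 0 < ennreal (g x) * indicator B x.
      ennreal (\<mu> x) * (ennreal (g x) * indicator B x))"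
    using g \<mu> B by (intro sum.mono_neutral_cong_right) (auto simp: indicator_def fin)
  also have "\<dots> = (\<integral>\<^sup>+x. ennreal (g x) * indicator B x \<partial>vertex_measure \<mu>)"
    unfolding vertex_measure_def by (rule nn_integral_point_measure[symmetric, OF fin])
  also have "\<dots> \<le> (\<integral>\<^sup>+x. ennreal (g x) \<partial>vertex_measure \<mu>)"
    by (intro nn_integral_mono) (auto simp: indicator_def)
  finally have le: "ennreal (\<Sum>x\<in>B. \<mu> x * g x) \<le> (\<integral>\<^sup>+x. ennreal (g x) \<partial>vertex_measure \<mu>)" .
  \<comment> \<open>Finiteness matters: \<open>enn2real\<close> sends \<open>\<infinity>\<close> to
    the default value 0.\<close>
  have "(\<integral>\<^sup>+x. ennreal (g x) \<partial>vertex_measure \<mu>) < \<infinity>"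
    using int g unfolding integrable_iff_bounded by (simp add: abs_of_pos)
  then have "enn2real (ennreal (\<Sum>x\<in>B. \<mu> x * g x)) \<le> enn2real (\<integral>\<^sup>+x. ennreal (g x) \<partial>vertex_measure \<mu>)"
    by (intro enn2real_mono le) simp
  moreover have "0 \<le> (\<Sum>x\<in>B. \<mu> x * g x)"
    using g \<mu> by (intro sum_nonneg mult_nonneg_nonneg less_imp_le)
  ultimately show ?thesis by simp
qed

text \<open>\<open>A\<close> is chosen with its sum within \<open>\<epsilon>\<close> of the supremum
  over the finite subsets of \<open>C\<close>. A disjoint \<open>B\<close> with sum at least
  \<open>\<epsilon>\<close> would lift \<open>A \<union> B\<close> above that supremum.\<close>

lemma finite_tail:
  fixes a :: "'v \<Rightarrow> real"
  assumes "\<And>B. finite B \<Longrightarrow> sum a B \<le> I" and "\<epsilon> > 0"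
  shows "\<exists>A. finite A \<and> A \<subseteq> C \<and> (\<forall>B. finite B \<and> B \<subseteq> C \<and> A \<inter> B = {} \<longrightarrow> sum a B < \<epsilon>)"
proof -
  define X where "X = sum a ` {B. finite B \<and> B \<subseteq> C}"
  have bdd: "bdd_above X" unfolding X_def using assms(1) by (auto intro!: bdd_aboveI)
  have "X \<noteq> {}" unfolding X_def by auto
  then obtain A where A: "finite A" "A \<subseteq> C" "Sup X - \<epsilon> < sum a A"
    using less_cSup_iff[OF _ bdd, of "Sup X - \<epsilon>"] assms(2) unfolding X_def by auto
  have "sum a B < \<epsilon>" if B: "finite B" "B \<subseteq> C" "A \<inter> B = {}" for B
  proof -
    have "sum a (A \<union> B) \<in> X" unfolding X_def using A B by auto
    then have "sum a (A \<union> B) \<le> Sup X" using bdd by (intro cSup_upper)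
    then show ?thesis using A B by (simp add: sum.union_disjoint)
  qed
  then show ?thesis using A by blast
qed

locale superlinear_problem =
  fixes E :: "'v set set" and w :: "'v \<Rightarrow> 'v \<Rightarrow> real" and \<mu> h :: "'v \<Rightarrow> real"
    and \<mu>_min h\<^sub>0 \<theta> :: real and f :: "'v \<Rightarrow> real \<Rightarrow> real"
  assumes loc_fin: "locally_finite E"
    and w_pos: "\<And>x y. {x, y} \<in> E \<Longrightarrow> w x y > 0"
    and w_sym: "\<And>x y. {x, y} \<in> E \<Longrightarrow> w x y = w y x"
    and \<mu>_min: "\<mu>_min > 0" "\<And>x. \<mu> x \<ge> \<mu>_min"
    and h_lower: "h\<^sub>0 > 0" "\<And>x. h x \<ge> h\<^sub>0"
    and h_L1: "integrable (vertex_measure \<mu>) (\<lambda>x. 1 / h x)"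
    and f_cont: "\<And>x. continuous_on UNIV (f x)"
    and f_zero: "\<And>x. f x 0 = 0"
    and f_bound: "\<And>M. M > 0 \<Longrightarrow> \<exists>A. \<forall>x. \<forall>s\<in>{0..M}. f x s \<le> A"
    and \<theta>: "\<theta> > 2"
    and f_AR: "\<And>x s. s > 0 \<Longrightarrow>
      0 < \<theta> * primitive f x s \<and> \<theta> * primitive f x s \<le> s * f x s"
begin

lemma \<mu>_pos: "\<mu> x > 0" and h_pos: "h x > 0"
  using \<mu>_min h_lower by (meson less_le_trans)+

lemma \<mu>h_ge: "\<mu> x * h x \<ge> \<mu>_min * h\<^sub>0"
  using \<mu>_min(1) h_lower(1) by (intro mult_mono \<mu>_min(2) h_lower(2)) (auto simp: \<mu>_pos less_imp_le)

subsection \<open>The nonlinearity\<close>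

lemma primitive_deriv: "(primitive f x has_real_derivative f x s) (at s)"
proof -
  \<comment> \<open>This interval has both 0 and \<open>s\<close> in its interior, whatever the sign
    of \<open>s\<close>, so the derivative within it is two-sided.\<close>
  have "((\<lambda>u. LBINT t=ereal 0..ereal u. f x t) has_vector_derivative f x s)
      (at s within {-\<bar>s\<bar> - 1..\<bar>s\<bar> + 1})"
    using f_cont by (intro interval_integral_FTC2) (auto intro: continuous_on_subset)
  moreover have "at s within {-\<bar>s\<bar> - 1..\<bar>s\<bar> + 1} = at s"
    by (intro at_within_interior) auto
  ultimately show ?thesis
    unfolding primitive_def[abs_def] by (simp add: has_real_derivative_iff_has_vector_derivative)
qed

lemma primitive_0 [simp]: "primitive f x 0 = 0"
  unfolding primitive_def by simp

lemma primitive_pos: "s > 0 \<Longrightarrow> primitive f x s > 0"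
  using f_AR[of s x] \<theta> by (simp add: zero_less_mult_iff)

lemma primitive_nonneg: "s \<ge> 0 \<Longrightarrow> primitive f x s \<ge> 0"
  using primitive_pos[of s x] by (cases "s = 0") auto

lemma primitive_AR: "s \<ge> 0 \<Longrightarrow> \<theta> * primitive f x s \<le> s * f x s"
  using f_AR[of s x] by (cases "s = 0") auto

lemma f_nonneg: "s \<ge> 0 \<Longrightarrow> f x s \<ge> 0"
proof (cases "s = 0")
  case False
  assume "s \<ge> 0"
  with False have s: "s > 0" by simp
  have "0 < s * f x s" using f_AR[OF s, of x] by linarith
  with s show ?thesis by (simp add: zero_less_mult_iff)
qed (simp add: f_zero)

lemma primitive_growth:
  "0 < s \<Longrightarrow> s \<le> t \<Longrightarrow> primitive f x s * t powr \<theta> \<le> primitive f x t * s powr \<theta>"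
  by (rule superhomogeneous_growth[OF primitive_deriv]) (use f_AR in auto)

text \<open>Uniformity in \<open>x\<close> comes from
  \<open>primitive f x 1 \<le> f x 1 \<le> A\<close> and the growth from \<open>s\<close> to 1. The
  factor 1/4 leaves half of the quadratic part of the functional.\<close>

lemma primitive_small:
  "\<exists>\<rho>>0. \<rho> \<le> 1 \<and> (\<forall>x s. 0 \<le> s \<longrightarrow> s \<le> \<rho> \<longrightarrow> primitive f x s \<le> h\<^sub>0 / 4 * s\<^sup>2)"
proof -
  obtain A' where A': "\<And>x s. s \<in> {0..1} \<Longrightarrow> f x s \<le> A'" using f_bound[of 1] zero_less_one by blast
  define A where "A = max 1 A'"
  have A: "A > 0" "f x 1 \<le> A" for x using A'[of 1 x] unfolding A_def by auto
  \<comment> \<open>The second entry solves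
    \<open>A * \<rho> powr (\<theta> - 2) = h\<^sub>0 / 4\<close>; the cap at 1 allows the growth
    comparison with the value at 1.\<close>
  define \<rho> where "\<rho> = min 1 ((h\<^sub>0 / (4 * A)) powr (1 / (\<theta> - 2)))"
  have \<rho>: "\<rho> > 0" "\<rho> \<le> 1" unfolding \<rho>_def using A h_lower by auto
  have "primitive f x s \<le> h\<^sub>0 / 4 * s\<^sup>2" if s: "0 \<le> s" "s \<le> \<rho>" for x s
  proof (cases "s = 0")
    case False
    with s have s0: "s > 0" by simp
    have "1 * primitive f x 1 \<le> \<theta> * primitive f x 1"
      using \<theta> primitive_nonneg[of 1 x] by (intro mult_right_mono) auto
    then have "primitive f x 1 \<le> A" using primitive_AR[of 1 x] A(2)[of x] by simp
    then have "primitive f x s \<le> A * s powr \<theta>"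
      using primitive_growth[OF s0, of 1 x] s \<rho> mult_right_mono[of "primitive f x 1" A "s powr \<theta>"]
      by simp
    also have "s powr \<theta> = s powr (\<theta> - 2) * s\<^sup>2"
      using s0 by (simp add: powr_diff powr_numeral)
    also have "A * \<dots> \<le> A * (h\<^sub>0 / (4 * A) * s\<^sup>2)"
    proof (intro mult_left_mono mult_right_mono)
      have "s powr (\<theta> - 2) \<le> ((h\<^sub>0 / (4 * A)) powr (1 / (\<theta> - 2))) powr (\<theta> - 2)"
        using s \<theta> unfolding \<rho>_def by (intro powr_mono2) auto
      also have "\<dots> = h\<^sub>0 / (4 * A)"
        using \<theta> A(1) h_lower(1) by (simp add: powr_powr)
      finally show "s powr (\<theta> - 2) \<le> h\<^sub>0 / (4 * A)" .
    qed (use A(1) in auto)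
    also have "\<dots> = h\<^sub>0 / 4 * s\<^sup>2" using A(1) by simp
    finally show ?thesis .
  qed simp
  with \<rho> show ?thesis by blast
qed

text \<open>The growth from 1 to \<open>s\<close> gives a lower bound of order
  \<open>s powr \<theta>\<close> with \<open>\<theta> > 2\<close>. \<open>R\<close> may depend on
  \<open>x\<close>, which suffices on finite sets.\<close>

lemma primitive_superquadratic:
  "\<exists>R\<ge>1. \<forall>s\<ge>R. c * s\<^sup>2 - \<mu> x * primitive f x s \<le> - B"
proof -
  define a where "a = \<mu> x * primitive f x 1"
  have a: "a > 0" unfolding a_def using \<mu>_pos primitive_pos by simp
  \<comment> \<open>For \<open>s \<ge> R\<close> the factor \<open>a * s powr (\<theta> - 2)\<close>
    is at least \<open>\<bar>c\<bar> + \<bar>B\<bar>\<close>; the cap from below by 1 gives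
    \<open>\<bar>B\<bar> \<le> \<bar>B\<bar> * s\<^sup>2\<close>.\<close>
  define R where "R = max 1 (((\<bar>c\<bar> + \<bar>B\<bar>) / a) powr (1 / (\<theta> - 2)))"
  have "c * s\<^sup>2 - \<mu> x * primitive f x s \<le> - B" if s: "s \<ge> R" for s
  proof -
    have s1: "s \<ge> 1" using s unfolding R_def by simp
    have "(\<bar>c\<bar> + \<bar>B\<bar>) / a = (((\<bar>c\<bar> + \<bar>B\<bar>) / a) powr (1 / (\<theta> - 2))) powr (\<theta> - 2)"
      using \<theta> a by (simp add: powr_powr)
    also have "\<dots> \<le> s powr (\<theta> - 2)"
      using s \<theta> unfolding R_def by (intro powr_mono2) auto
    finally have "\<bar>c\<bar> + \<bar>B\<bar> \<le> a * s powr (\<theta> - 2)" using a by (simp add: field_simps)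
    then have "(\<bar>c\<bar> + \<bar>B\<bar>) * s\<^sup>2 \<le> a * s powr (\<theta> - 2) * s\<^sup>2" by (rule mult_right_mono) simp
    also have "\<dots> = a * s powr \<theta>" using s1 by (simp add: powr_diff powr_numeral)
    also have "\<dots> \<le> \<mu> x * primitive f x s"
      unfolding a_def using primitive_growth[of 1 s x] s1 \<mu>_pos[of x] by (simp add: mult.assoc)
    finally have 1: "(\<bar>c\<bar> + \<bar>B\<bar>) * s\<^sup>2 \<le> \<mu> x * primitive f x s" .
    have "\<bar>B\<bar> * 1 \<le> \<bar>B\<bar> * s\<^sup>2" using s1 by (intro mult_left_mono) auto
    moreover have "c * s\<^sup>2 \<le> \<bar>c\<bar> * s\<^sup>2" by (intro mult_right_mono) auto
    ultimately show ?thesis using 1 by (simp add: algebra_simps)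
  qed
  then show ?thesis unfolding R_def by (intro exI[of _ R]) (auto simp: R_def)
qed

subsection \<open>The Dirichlet problem on a finite set of vertices\<close>

text \<open>Weights are extended by 0 to non-edges, so that sums may run over any finite set of
  vertices.\<close>

definition conductance :: "'v \<Rightarrow> 'v \<Rightarrow> real" where
  "conductance x y = (if {x, y} \<in> E then w x y else 0)"

text \<open>The sum includes neighbours outside a given \<open>\<Omega>\<close>, which encodes zero
  boundary values. A loop adds the same weight here and to \<open>conductance x x\<close>, so it
  cancels in the energy.\<close>

definition diagonal :: "'v \<Rightarrow> real" where
  "diagonal x = (\<Sum>y\<in>neighbours E x. w x y) + \<mu> x * h x"

text \<open>For \<open>u\<close> vanishing outside a finite \<open>\<Omega>\<close> this is the
  integral of the squared gradient norm plus \<open>h u^2\<close>, expanded as a quadratic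
  form.\<close>

definition energy :: "'v set \<Rightarrow> ('v \<Rightarrow> real) \<Rightarrow> real" where
  "energy \<Omega> u = (\<Sum>x\<in>\<Omega>. diagonal x * (u x)\<^sup>2) - (\<Sum>x\<in>\<Omega>. \<Sum>y\<in>\<Omega>. conductance x y * (u x * u y))"

definition functional :: "'v set \<Rightarrow> ('v \<Rightarrow> real) \<Rightarrow> real" where
  "functional \<Omega> u = energy \<Omega> u / 2 - (\<Sum>x\<in>\<Omega>. \<mu> x * primitive f x (u x))"

text \<open>This is the gradient of \<open>functional \<Omega>\<close>. For finite
  \<open>\<Omega>\<close> and \<open>u\<close> vanishing outside it, the value at \<open>x\<close>
  in \<open>\<Omega>\<close> is \<open>\<mu> x\<close> times the defect of the equation.\<close>

definition residual :: "'v set \<Rightarrow> ('v \<Rightarrow> real) \<Rightarrow> 'v \<Rightarrow> real" where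
  "residual \<Omega> u x = (if x \<in> \<Omega>
     then diagonal x * u x - (\<Sum>y\<in>\<Omega>. conductance x y * u y) - \<mu> x * f x (u x) else 0)"

lemma conductance_sym: "conductance x y = conductance y x"
  unfolding conductance_def using w_sym[of x y] by (simp add: insert_commute)

lemma conductance_nonneg: "conductance x y \<ge> 0"
  unfolding conductance_def using w_pos[of x y] by auto

lemma finite_neighbours: "finite (neighbours E x)"
  using loc_fin unfolding locally_finite_def by blast

lemma diagonal_pos: "diagonal x > 0"
proof -
  have "(\<Sum>y\<in>neighbours E x. w x y) \<ge> 0"
    by (rule sum_nonneg) (auto simp: neighbours_def w_pos less_imp_le)
  then show ?thesis unfolding diagonal_def using \<mu>_pos[of x] h_pos[of x] by (simp add: add_nonneg_pos)
qed

lemma sum_conductance_superset: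
  assumes "finite \<Omega>" "neighbours E x \<subseteq> \<Omega>"
  shows "(\<Sum>y\<in>\<Omega>. conductance x y * u y) = (\<Sum>y\<in>neighbours E x. w x y * u y)"
  using assms by (intro sum.mono_neutral_cong_right) (auto simp: conductance_def neighbours_def)

lemma sum_conductance_le:
  assumes "finite \<Omega>"
  shows "(\<Sum>y\<in>\<Omega>. conductance x y) \<le> diagonal x - \<mu> x * h x"
proof -
  have "(\<Sum>y\<in>\<Omega>. conductance x y) \<le> (\<Sum>y\<in>\<Omega> \<union> neighbours E x. conductance x y * 1)"
    using assms finite_neighbours conductance_nonneg by (simp, intro sum_mono2) auto
  also have "\<dots> = (\<Sum>y\<in>neighbours E x. w x y * 1)"
    using assms finite_neighbours by (intro sum_conductance_superset) auto
  finally show ?thesis unfolding diagonal_def by simp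
qed

section \<open>Coercivity of the energy and the gradient of the functional\<close>

text \<open>The gradient part of the energy is nonnegative: each product \<open>u x * u y\<close> is
  at most the mean of the two squares, symmetry merges the two resulting sums, and
  \<open>sum_conductance_le\<close> bounds the row sums.\<close>

lemma energy_ge:
  assumes fin: "finite \<Omega>"
  shows "(\<Sum>x\<in>\<Omega>. \<mu> x * h x * (u x)\<^sup>2) \<le> energy \<Omega> u"
proof -
  have "(\<Sum>x\<in>\<Omega>. \<Sum>y\<in>\<Omega>. conductance x y * (u x * u y))
      \<le> (\<Sum>x\<in>\<Omega>. \<Sum>y\<in>\<Omega>. conductance x y * ((u x)\<^sup>2 / 2) + conductance y x * ((u y)\<^sup>2 / 2))"
  proof (intro sum_mono)
    fix x y
    have "u x * u y \<le> (u x)\<^sup>2 / 2 + (u y)\<^sup>2 / 2"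
      using sum_squares_bound[of "u x" "u y"] by simp
    from mult_left_mono[OF this conductance_nonneg[of x y]]
    show "conductance x y * (u x * u y) \<le> conductance x y * ((u x)\<^sup>2 / 2) + conductance y x * ((u y)\<^sup>2 / 2)"
      by (simp add: distrib_left conductance_sym[of y x])
  qed
  also have "\<dots> = (\<Sum>x\<in>\<Omega>. \<Sum>y\<in>\<Omega>. conductance x y * ((u x)\<^sup>2 / 2))
      + (\<Sum>x\<in>\<Omega>. \<Sum>y\<in>\<Omega>. conductance y x * ((u y)\<^sup>2 / 2))"
    by (simp add: sum.distrib)
  also have "(\<Sum>x\<in>\<Omega>. \<Sum>y\<in>\<Omega>. conductance y x * ((u y)\<^sup>2 / 2))
      = (\<Sum>x\<in>\<Omega>. \<Sum>y\<in>\<Omega>. conductance x y * ((u x)\<^sup>2 / 2))"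
    by (rule sum.swap)
  also have "(\<Sum>x\<in>\<Omega>. \<Sum>y\<in>\<Omega>. conductance x y * ((u x)\<^sup>2 / 2))
      + (\<Sum>x\<in>\<Omega>. \<Sum>y\<in>\<Omega>. conductance x y * ((u x)\<^sup>2 / 2))
      = (\<Sum>x\<in>\<Omega>. (\<Sum>y\<in>\<Omega>. conductance x y) * (u x)\<^sup>2)"
    unfolding sum.distrib[symmetric] sum_distrib_right by (intro sum.cong refl) simp
  also have "\<dots> \<le> (\<Sum>x\<in>\<Omega>. (diagonal x - \<mu> x * h x) * (u x)\<^sup>2)"
    by (intro sum_mono mult_right_mono sum_conductance_le fin) auto
  finally show ?thesis
    unfolding energy_def by (simp add: left_diff_distrib sum_subtractf)
qed

text \<open>Symmetry of \<open>conductance\<close> makes both terms of the product rule contribute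
  equally, which absorbs the factor 1/2 of the functional. The direction is \<open>- v\<close>
  because the mountain pass descends along the gradient.\<close>

lemma functional_deriv:
  "((\<lambda>\<tau>. functional \<Omega> (\<lambda>x. u x - \<tau> * v x)) has_real_derivative
     - (\<Sum>x\<in>\<Omega>. residual \<Omega> (\<lambda>x. u x - t * v x) x * v x)) (at t)"
proof -
  define U where "U = (\<lambda>x. u x - t * v x)"
  have F: "((\<lambda>\<tau>. primitive f x (u x - \<tau> * v x)) has_real_derivative f x (U x) * - v x) (at t)" for x
    unfolding U_def by (rule DERIV_chain2[OF primitive_deriv]) (auto intro!: derivative_eq_intros)
  have D1: "((\<lambda>\<tau>. \<Sum>x\<in>\<Omega>. diagonal x * (u x - \<tau> * v x)\<^sup>2) has_real_derivative
      (\<Sum>x\<in>\<Omega>. diagonal x * (2 * (U x * - v x)))) (at t)"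
    by (rule DERIV_sum) (auto intro!: derivative_eq_intros simp: U_def)
  have D2: "((\<lambda>\<tau>. \<Sum>x\<in>\<Omega>. \<Sum>y\<in>\<Omega>. conductance x y * ((u x - \<tau> * v x) * (u y - \<tau> * v y)))
      has_real_derivative (\<Sum>x\<in>\<Omega>. \<Sum>y\<in>\<Omega>. conductance x y * (- v x * U y + - v y * U x))) (at t)"
    by (rule DERIV_sum, rule DERIV_sum) (auto intro!: derivative_eq_intros simp: U_def)
  have D3: "((\<lambda>\<tau>. \<Sum>x\<in>\<Omega>. \<mu> x * primitive f x (u x - \<tau> * v x)) has_real_derivative
      (\<Sum>x\<in>\<Omega>. \<mu> x * (f x (U x) * - v x))) (at t)"
    by (intro DERIV_sum DERIV_cmult F)
  note D = DERIV_diff[OF DERIV_cdivide[OF DERIV_diff[OF D1 D2], of 2] D3]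
  have swap: "(\<Sum>x\<in>\<Omega>. \<Sum>y\<in>\<Omega>. conductance x y * (v y * U x))
      = (\<Sum>x\<in>\<Omega>. \<Sum>y\<in>\<Omega>. conductance x y * (v x * U y))"
    by (subst sum.swap) (simp add: conductance_sym)
  have s1: "(\<Sum>x\<in>\<Omega>. \<Sum>y\<in>\<Omega>. conductance x y * (- v x * U y + - v y * U x))
      = - 2 * (\<Sum>x\<in>\<Omega>. \<Sum>y\<in>\<Omega>. conductance x y * (v x * U y))"
    using swap by (simp add: distrib_left right_diff_distrib sum.distrib sum_subtractf sum_negf)
  have s2: "(\<Sum>x\<in>\<Omega>. residual \<Omega> U x * v x) = (\<Sum>x\<in>\<Omega>. diagonal x * (U x * v x))
      - (\<Sum>x\<in>\<Omega>. \<Sum>y\<in>\<Omega>. conductance x y * (v x * U y)) - (\<Sum>x\<in>\<Omega>. \<mu> x * (f x (U x) * v x))"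
    unfolding sum_subtractf[symmetric]
    by (intro sum.cong refl)
      (simp add: residual_def sum_distrib_left sum_distrib_right algebra_simps)
  have s3: "(\<Sum>x\<in>\<Omega>. diagonal x * (2 * (U x * - v x))) = - 2 * (\<Sum>x\<in>\<Omega>. diagonal x * (U x * v x))"
    "(\<Sum>x\<in>\<Omega>. \<mu> x * (f x (U x) * - v x)) = - (\<Sum>x\<in>\<Omega>. \<mu> x * (f x (U x) * v x))"
    by (simp_all add: sum_negf sum_distrib_left mult_ac)
  have "((\<Sum>x\<in>\<Omega>. diagonal x * (2 * (U x * - v x)))
       - (\<Sum>x\<in>\<Omega>. \<Sum>y\<in>\<Omega>. conductance x y * (- v x * U y + - v y * U x))) / 2
     - (\<Sum>x\<in>\<Omega>. \<mu> x * (f x (U x) * - v x)) = - (\<Sum>x\<in>\<Omega>. residual \<Omega> U x * v x)"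
    unfolding s1 s2 s3 by (simp add: field_simps)
  with D show ?thesis unfolding functional_def energy_def U_def[symmetric] by simp
qed

lemma continuous_on_f_coord: "continuous_on UNIV (\<lambda>u. f x (u x))"
  and continuous_on_primitive_coord: "continuous_on UNIV (\<lambda>u. primitive f x (u x))"
proof -
  have "continuous_on UNIV (primitive f x)"
    by (meson DERIV_isCont continuous_at_imp_continuous_on primitive_deriv)
  then show "continuous_on UNIV (\<lambda>u. primitive f x (u x))"
    by (rule continuous_on_compose2[OF _ continuous_on_product_coordinates]) auto
  show "continuous_on UNIV (\<lambda>u. f x (u x))"
    by (rule continuous_on_compose2[OF f_cont continuous_on_product_coordinates]) auto
qed

lemma continuous_on_functional: "continuous_on UNIV (functional \<Omega>)"
  unfolding functional_def energy_def
  by (intro continuous_intros continuous_on_primitive_coord continuous_on_product_coordinates) auto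

lemma continuous_on_residual: "continuous_on UNIV (\<lambda>u. residual \<Omega> u x)"
  unfolding residual_def
  by (cases "x \<in> \<Omega>")
    (auto intro!: continuous_intros continuous_on_f_coord continuous_on_product_coordinates)

text \<open>The value does not involve \<open>\<Omega>\<close>, which makes the upper bound on the
  mountain pass level independent of it. \<open>conductance z z\<close> is nonzero only if there is
  a loop at \<open>z\<close>.\<close>

lemma functional_single:
  assumes "finite \<Omega>" "z \<in> \<Omega>"
  shows "functional \<Omega> (\<lambda>x. if x = z then s else 0)
    = (diagonal z - conductance z z) / 2 * s\<^sup>2 - \<mu> z * primitive f z s"
proof -
  have 1: "(\<Sum>x\<in>\<Omega>. \<mu> x * primitive f x (if x = z then s else 0))
      = (\<Sum>x\<in>\<Omega>. if x = z then \<mu> z * primitive f z s else 0)"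
    by (intro sum.cong) auto
  have 2: "(\<Sum>x\<in>\<Omega>. diagonal x * (if x = z then s else 0)\<^sup>2)
      = (\<Sum>x\<in>\<Omega>. if x = z then diagonal z * s\<^sup>2 else 0)"
    by (intro sum.cong) auto
  have "(\<Sum>x\<in>\<Omega>. \<Sum>y\<in>\<Omega>. conductance x y * ((if x = z then s else 0) * (if y = z then s else 0)))
      = (\<Sum>x\<in>\<Omega>. if x = z then (\<Sum>y\<in>\<Omega>. if y = z then conductance z z * s\<^sup>2 else 0) else 0)"
    by (intro sum.cong refl) (auto simp: power2_eq_square intro!: sum.cong)
  then show ?thesis
    unfolding functional_def energy_def 1 2 using assms by (simp add: field_simps)
qed

section \<open>A priori bound and invariance of the cone\<close>

text \<open>On the cone the interaction term of the energy is nonnegative. Dropping it leaves a sum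
  of functions \<open>p x\<close> of one variable, each bounded above and tending to minus infinity,
  so a single large coordinate makes the functional negative.\<close>

lemma functional_nonneg_bounded:
  assumes fin: "finite \<Omega>"
  shows "\<exists>R. \<forall>u\<in>nonneg_supported \<Omega>. functional \<Omega> u \<ge> 0 \<longrightarrow> (\<forall>x. u x \<le> R)"
proof -
  define p where "p x s = diagonal x / 2 * s\<^sup>2 - \<mu> x * primitive f x s" for x s
  have "\<exists>B\<ge>0. \<forall>s\<ge>0. p x s \<le> B" for x
  proof -
    obtain R where R: "R \<ge> 1" "\<And>s. s \<ge> R \<Longrightarrow> p x s \<le> 0"
      using primitive_superquadratic[of "diagonal x / 2" x 0] unfolding p_def by auto
    have "p x s \<le> diagonal x / 2 * R\<^sup>2" if "s \<ge> 0" for s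
    proof (cases "s \<ge> R")
      case True
      then show ?thesis using R(2)[of s] diagonal_pos[of x] by (intro order_trans[OF R(2)]) auto
    next
      case False
      then have "diagonal x / 2 * s\<^sup>2 \<le> diagonal x / 2 * R\<^sup>2"
        using that diagonal_pos[of x] by (intro mult_left_mono power_mono) auto
      moreover have "\<mu> x * primitive f x s \<ge> 0"
        using \<mu>_pos[of x] primitive_nonneg[OF that, of x] by simp
      ultimately show ?thesis unfolding p_def by linarith
    qed
    then show ?thesis using diagonal_pos[of x] by (intro exI[of _ "diagonal x / 2 * R\<^sup>2"]) auto
  qed
  then obtain B where B: "\<And>x. B x \<ge> 0" "\<And>x s. s \<ge> 0 \<Longrightarrow> p x s \<le> B x" by metis
  have "\<exists>R\<ge>0. \<forall>s\<ge>R. p x s \<le> - (sum B \<Omega> + 1)" for x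
  proof -
    obtain R where "R \<ge> 1" "\<forall>s\<ge>R. p x s \<le> - (sum B \<Omega> + 1)"
      using primitive_superquadratic[of "diagonal x / 2" x "sum B \<Omega> + 1"] unfolding p_def by blast
    then show ?thesis by (intro exI[of _ R]) auto
  qed
  then obtain R where R: "\<And>x. R x \<ge> 0" "\<And>x s. s \<ge> R x \<Longrightarrow> p x s \<le> - (sum B \<Omega> + 1)" by metis
  have "u x \<le> sum R \<Omega>" if u: "u \<in> nonneg_supported \<Omega>" "functional \<Omega> u \<ge> 0" for u x
  proof (cases "x \<in> \<Omega>")
    case True
    have "0 \<le> (\<Sum>x\<in>\<Omega>. \<Sum>y\<in>\<Omega>. conductance x y * (u x * u y))"
      using u(1) conductance_nonneg by (auto simp: nonneg_supported_def intro!: sum_nonneg)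
    then have "functional \<Omega> u \<le> (\<Sum>x\<in>\<Omega>. p x (u x))"
      unfolding functional_def energy_def p_def by (simp add: sum_subtractf sum_divide_distrib[symmetric] diff_divide_distrib)
    also have "\<dots> = p x (u x) + (\<Sum>y\<in>\<Omega> - {x}. p y (u y))" by (rule sum.remove[OF fin True])
    also have "\<dots> \<le> p x (u x) + sum B \<Omega>"
    proof -
      have "(\<Sum>y\<in>\<Omega> - {x}. p y (u y)) \<le> sum B (\<Omega> - {x})"
        using u(1) B by (intro sum_mono) (auto simp: nonneg_supported_def)
      also have "\<dots> \<le> sum B \<Omega>" using fin B by (intro sum_mono2) auto
      finally show ?thesis by simp
    qed
    finally have "\<not> p x (u x) \<le> - (sum B \<Omega> + 1)" using u(2) by simp
    then have "u x \<le> R x" using R(2)[of x "u x"] by linarith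
    also have "\<dots> \<le> sum R \<Omega>" using fin True R by (intro member_le_sum) auto
    finally show ?thesis .
  next
    case False
    then show ?thesis using u(1) R by (auto simp: nonneg_supported_def intro: sum_nonneg)
  qed
  then show ?thesis by blast
qed

text \<open>Only the term \<open>s * diagonal x * u x\<close> lowers the value at \<open>x\<close>,
  and it is at most \<open>u x\<close> for \<open>s \<le> T\<close>. The interaction term and
  \<open>f\<close> push upwards on the cone. The summand 1 in \<open>T\<close> keeps the denominator
  positive for empty \<open>\<Omega>\<close>.\<close>

lemma residual_step_in_cone:
  assumes fin: "finite \<Omega>"
  shows "\<exists>T>0. \<forall>u s. u \<in> nonneg_supported \<Omega> \<longrightarrow> 0 \<le> s \<longrightarrow> s \<le> T \<longrightarrow> (\<lambda>x. u x - s * residual \<Omega> u x) \<in> nonneg_supported \<Omega>"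
proof -
  define T where "T = 1 / (1 + sum diagonal \<Omega>)"
  have S: "sum diagonal \<Omega> \<ge> 0" by (intro sum_nonneg less_imp_le diagonal_pos)
  have "u x - s * residual \<Omega> u x \<ge> 0" if u: "u \<in> nonneg_supported \<Omega>" and s: "0 \<le> s" "s \<le> T" and x: "x \<in> \<Omega>" for u s x
  proof -
    have "diagonal x \<le> sum diagonal \<Omega>" using fin x diagonal_pos by (intro member_le_sum) (auto intro: less_imp_le)
    then have "s * diagonal x \<le> T * (1 + sum diagonal \<Omega>)"
      using s diagonal_pos[of x] by (intro mult_mono) auto
    also have "\<dots> = 1" unfolding T_def using S by simp
    finally have "s * diagonal x * u x \<le> 1 * u x"
      using u by (intro mult_right_mono) (auto simp: nonneg_supported_def)
    moreover have "0 \<le> s * ((\<Sum>y\<in>\<Omega>. conductance x y * u y) + \<mu> x * f x (u x))"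
      using u s conductance_nonneg f_nonneg \<mu>_pos
      by (intro mult_nonneg_nonneg add_nonneg_nonneg sum_nonneg) (auto simp: nonneg_supported_def less_imp_le)
    ultimately show ?thesis using x by (simp add: residual_def algebra_simps)
  qed
  then have "(\<lambda>x. u x - s * residual \<Omega> u x) \<in> nonneg_supported \<Omega>" if "u \<in> nonneg_supported \<Omega>" "0 \<le> s" "s \<le> T" for u s
    using that by (auto simp: nonneg_supported_def residual_def)
  moreover have "T > 0" unfolding T_def using S by simp
  ultimately show ?thesis by blast
qed

section \<open>Solutions on finite sets with uniform energy bounds\<close>

text \<open>The order of quantifiers is the point: \<open>\<alpha>\<close> and
  \<open>\<beta>\<close> are fixed before \<open>\<Omega>\<close>. The ridge is described by global
  constants, and the far end \<open>e\<close> of the path is concentrated at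
  \<open>z\<close>.\<close>

lemma finite_dirichlet_solution:
  "\<exists>\<alpha>>0. \<exists>\<beta>. \<forall>\<Omega>. finite \<Omega> \<longrightarrow> z \<in> \<Omega> \<longrightarrow>
     (\<exists>u\<in>nonneg_supported \<Omega>. (\<forall>x\<in>\<Omega>. residual \<Omega> u x = 0) \<and> \<alpha> \<le> functional \<Omega> u \<and> functional \<Omega> u \<le> \<beta>)"
proof -
  obtain \<rho> where \<rho>: "\<rho> > 0" "\<rho> \<le> 1"
    and small: "\<And>x s. 0 \<le> s \<Longrightarrow> s \<le> \<rho> \<Longrightarrow> primitive f x s \<le> h\<^sub>0 / 4 * s\<^sup>2"
    using primitive_small by blast
  \<comment> \<open>If the weighted square sum \<open>N u\<close> equals \<open>r\<close>, every
    coordinate of \<open>u\<close> in the cone is at most \<open>\<rho>\<close>, so that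
    \<open>small\<close> applies at each vertex.\<close>
  define r where "r = \<mu>_min * h\<^sub>0 * \<rho>\<^sup>2"
  have mh: "\<mu>_min * h\<^sub>0 > 0" using \<mu>_min h_lower by simp
  have r: "r > 0" unfolding r_def using mh \<rho> by simp
  define c where "c = (diagonal z - conductance z z) / 2"
  \<comment> \<open>\<open>S \<ge> 1 \<ge> \<rho>\<close> places \<open>e\<close> beyond the ridge
    \<open>N = r\<close>.\<close>
  obtain S where S: "S \<ge> 1" "c * S\<^sup>2 - \<mu> z * primitive f z S \<le> 0"
    using primitive_superquadratic[of c z 0] by auto
  define e where "e = (\<lambda>x. if x = z then S else 0)"
  \<comment> \<open>\<open>r / 4\<close> bounds the functional from below on the ridge;
    \<open>mountain_pass_cone\<close> keeps half of it.\<close>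
  have "\<exists>u\<in>nonneg_supported \<Omega>. (\<forall>x\<in>\<Omega>. residual \<Omega> u x = 0) \<and> r / 4 / 2 \<le> functional \<Omega> u \<and> functional \<Omega> u \<le> \<bar>c\<bar> * S\<^sup>2"
    if fin: "finite \<Omega>" and z: "z \<in> \<Omega>" for \<Omega>
  proof -
    define N where "N u = (\<Sum>x\<in>\<Omega>. \<mu> x * h x * (u x)\<^sup>2)" for u
    obtain R where R: "\<And>u x. u \<in> nonneg_supported \<Omega> \<Longrightarrow> functional \<Omega> u \<ge> 0 \<Longrightarrow> u x \<le> R"
      using functional_nonneg_bounded[OF fin] by blast
    obtain T where T: "T > 0"
      "\<And>u s. u \<in> nonneg_supported \<Omega> \<Longrightarrow> 0 \<le> s \<Longrightarrow> s \<le> T \<Longrightarrow> (\<lambda>x. u x - s * residual \<Omega> u x) \<in> nonneg_supported \<Omega>"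
      using residual_step_in_cone[OF fin] by blast
    show ?thesis
    proof (rule mountain_pass_cone[where N = N and e = e and r = r and T = T and R = R])
      show "continuous_on UNIV N"
        unfolding N_def by (intro continuous_intros continuous_on_product_coordinates)
      show "r / 4 \<le> functional \<Omega> u" if u: "u \<in> nonneg_supported \<Omega>" "N u = r" for u
      proof -
        have nn: "0 \<le> \<mu> x * h x * (u x)\<^sup>2" for x using \<mu>_pos[of x] h_pos[of x] by simp
        have "\<mu> x * primitive f x (u x) \<le> \<mu> x * h x * (u x)\<^sup>2 / 4" if x: "x \<in> \<Omega>" for x
        proof -
          have ux: "u x \<ge> 0" using u by (simp add: nonneg_supported_def)
          have "\<mu>_min * h\<^sub>0 * (u x)\<^sup>2 \<le> \<mu> x * h x * (u x)\<^sup>2"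
            by (intro mult_right_mono \<mu>h_ge) simp
          also have "\<dots> \<le> N u" unfolding N_def using fin x nn by (intro member_le_sum) auto
          finally have "(u x)\<^sup>2 \<le> \<rho>\<^sup>2" using mh u(2) unfolding r_def by (simp only: mult_le_cancel_left_pos)
          then have "u x \<le> \<rho>" using \<rho>(1) by (rule power2_le_imp_le[OF _ less_imp_le])
          then have "primitive f x (u x) \<le> h\<^sub>0 / 4 * (u x)\<^sup>2" using small ux by blast
          also have "\<dots> \<le> h x / 4 * (u x)\<^sup>2" using h_lower by (intro mult_right_mono) auto
          finally have "\<mu> x * primitive f x (u x) \<le> \<mu> x * (h x / 4 * (u x)\<^sup>2)"
            using \<mu>_pos[of x] by simp
          then show ?thesis by simp
        qed
        then have "(\<Sum>x\<in>\<Omega>. \<mu> x * primitive f x (u x)) \<le> (\<Sum>x\<in>\<Omega>. \<mu> x * h x * (u x)\<^sup>2 / 4)"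
          by (rule sum_mono)
        also have "\<dots> = N u / 4" unfolding N_def by (rule sum_divide_distrib[symmetric])
        finally show ?thesis
          using energy_ge[OF fin, of u] u(2) unfolding functional_def N_def by simp
      qed
      have scale: "(\<lambda>x. s * e x) = (\<lambda>x. if x = z then s * S else 0)" for s
        unfolding e_def by auto
      show "functional \<Omega> (\<lambda>x. s * e x) \<le> \<bar>c\<bar> * S\<^sup>2" if s: "0 \<le> s" "s \<le> 1" for s
      proof -
        have "c * (s * S)\<^sup>2 \<le> \<bar>c\<bar> * S\<^sup>2"
          using s S by (intro mult_mono power_mono) (auto simp: mult_left_le_one_le)
        moreover have "\<mu> z * primitive f z (s * S) \<ge> 0"
          using \<mu>_pos[of z] primitive_nonneg[of "s * S" z] s S by simp
        ultimately show ?thesis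
          unfolding scale functional_single[OF fin z] c_def[symmetric] by linarith
      qed
      show "functional \<Omega> e \<le> 0"
        unfolding e_def functional_single[OF fin z] using S(2) c_def by simp
      show "functional \<Omega> (\<lambda>x. 0) \<le> 0" unfolding functional_def energy_def by simp
      show "N (\<lambda>x. 0) \<le> r" unfolding N_def using r by simp
      show "e \<in> nonneg_supported \<Omega>" unfolding e_def nonneg_supported_def using S z by auto
      have "r \<le> \<mu> z * h z * S\<^sup>2"
        unfolding r_def using \<rho> S mh \<mu>h_ge[of z]
        by (intro mult_mono[of "\<mu>_min * h\<^sub>0"] power_mono) auto
      also have "\<dots> = (\<Sum>x\<in>\<Omega>. if x = z then \<mu> z * h z * S\<^sup>2 else 0)" using fin z by simp
      also have "\<dots> = N e" unfolding N_def e_def by (intro sum.cong) auto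
      finally show "r \<le> N e" .
      show "residual \<Omega> u x = 0" if "x \<notin> \<Omega>" for u x using that by (simp add: residual_def)
      show "(\<lambda>x. u x - s * residual \<Omega> u x) \<in> nonneg_supported \<Omega>"
        if "u \<in> nonneg_supported \<Omega>" "0 \<le> s" "s \<le> T" for u s
        using that by (rule T(2))
      show "u x \<le> R" if "u \<in> nonneg_supported \<Omega>" "0 \<le> functional \<Omega> u" for u x
        using that by (rule R)
      show "r / 4 > 0" using r by simp
    qed (rule fin functional_deriv continuous_on_functional continuous_on_residual T(1))+
  qed
  moreover have "r / 4 / 2 > 0" using r by simp
  ultimately show ?thesis by blast
qed

text \<open>Testing the equation with \<open>u\<close> itself gives the identity, and
  \<open>primitive_AR\<close> then bounds the nonlinear part by
  \<open>energy \<Omega> u / \<theta>\<close>. As \<open>\<theta> > 2\<close>, level and energy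
  control each other.\<close>

lemma critical_energy_bounds:
  assumes fin: "finite \<Omega>" and u: "u \<in> nonneg_supported \<Omega>" and crit: "\<And>x. x \<in> \<Omega> \<Longrightarrow> residual \<Omega> u x = 0"
  shows "energy \<Omega> u = (\<Sum>x\<in>\<Omega>. \<mu> x * (f x (u x) * u x))"
    and "(1 / 2 - 1 / \<theta>) * energy \<Omega> u \<le> functional \<Omega> u"
    and "functional \<Omega> u \<le> energy \<Omega> u / 2"
proof -
  have "\<mu> x * (f x (u x) * u x) = diagonal x * (u x)\<^sup>2 - (\<Sum>y\<in>\<Omega>. conductance x y * (u x * u y))"
    if x: "x \<in> \<Omega>" for x
  proof -
    have "\<mu> x * f x (u x) = diagonal x * u x - (\<Sum>y\<in>\<Omega>. conductance x y * u y)"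
      using crit[OF x] x unfolding residual_def by simp
    then have "\<mu> x * (f x (u x) * u x) = (diagonal x * u x - (\<Sum>y\<in>\<Omega>. conductance x y * u y)) * u x"
      by (simp only: mult.assoc[symmetric])
    also have "\<dots> = diagonal x * (u x)\<^sup>2 - (\<Sum>y\<in>\<Omega>. conductance x y * (u x * u y))"
      unfolding left_diff_distrib sum_distrib_right by (simp add: power2_eq_square mult_ac)
    finally show ?thesis .
  qed
  then show E: "energy \<Omega> u = (\<Sum>x\<in>\<Omega>. \<mu> x * (f x (u x) * u x))"
    unfolding energy_def by (simp add: sum_subtractf)
  have "\<mu> x * primitive f x (u x) \<le> \<mu> x * (f x (u x) * u x) / \<theta>" for x
  proof -
    have "\<theta> * primitive f x (u x) \<le> u x * f x (u x)"
      using u by (intro primitive_AR) (simp add: nonneg_supported_def)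
    then have "\<mu> x * (\<theta> * primitive f x (u x)) \<le> \<mu> x * (u x * f x (u x))"
      using \<mu>_pos[of x] by simp
    then show ?thesis using \<theta> by (simp add: field_simps)
  qed
  then have "(\<Sum>x\<in>\<Omega>. \<mu> x * primitive f x (u x)) \<le> (\<Sum>x\<in>\<Omega>. \<mu> x * (f x (u x) * u x) / \<theta>)"
    by (intro sum_mono)
  also have "\<dots> = energy \<Omega> u / \<theta>" unfolding E by (rule sum_divide_distrib[symmetric])
  finally show "(1 / 2 - 1 / \<theta>) * energy \<Omega> u \<le> functional \<Omega> u"
    unfolding functional_def by (simp add: left_diff_distrib)
  have "0 \<le> (\<Sum>x\<in>\<Omega>. \<mu> x * primitive f x (u x))"
    using u \<mu>_pos primitive_nonneg by (intro sum_nonneg mult_nonneg_nonneg) (auto simp: nonneg_supported_def less_imp_le)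
  then show "functional \<Omega> u \<le> energy \<Omega> u / 2" unfolding functional_def by simp
qed

subsection \<open>Exhaustion of a connected component\<close>

definition component :: "'v \<Rightarrow> 'v set" where
  "component z = {(x, y). {x, y} \<in> E}\<^sup>* `` {z}"

lemma component_refl: "z \<in> component z"
  unfolding component_def by auto

lemma neighbours_subset_component: "x \<in> component z \<Longrightarrow> neighbours E x \<subseteq> component z"
  unfolding component_def neighbours_def by (auto intro: rtrancl.rtrancl_into_rtrancl)

lemma component_connected:
  assumes "x \<in> component z" "y \<in> component z"
  shows "(x, y) \<in> {(x, y). {x, y} \<in> E}\<^sup>*"
proof -
  have "sym ({(x, y). {x, y} \<in> E}\<^sup>*)" by (intro sym_rtrancl symI) (auto simp: insert_commute)
  then have "(x, z) \<in> {(x, y). {x, y} \<in> E}\<^sup>*" using assms(1) unfolding component_def by (auto dest: symD)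
  then show ?thesis using assms(2) unfolding component_def by auto
qed

lemma component_eq:
  assumes x: "x \<in> component z"
  shows "component x = component z"
proof
  show "component x \<subseteq> component z"
    using x unfolding component_def by (meson Image_singleton_iff rtrancl_trans subsetI)
  show "component z \<subseteq> component x"
    using component_connected[OF x] unfolding component_def by blast
qed

text \<open>The exhaustion stays inside one component so that nontriviality, found at some vertex of
  it, spreads along edges to every other vertex.\<close>

lemma component_solution:
  "\<exists>u. \<forall>x\<in>component z. u x > 0 \<and> - laplacian E w \<mu> u x + h x * u x = f x (u x)"
proof -
  let ?C = "component z"
  obtain \<alpha> \<beta> where \<alpha>: "\<alpha> > 0" and
    "\<And>\<Omega>. finite \<Omega> \<Longrightarrow> z \<in> \<Omega> \<Longrightarrow> \<exists>u\<in>nonneg_supported \<Omega>. (\<forall>x\<in>\<Omega>. residual \<Omega> u x = 0) \<and>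
      \<alpha> \<le> functional \<Omega> u \<and> functional \<Omega> u \<le> \<beta>"
    using finite_dirichlet_solution[of z] by blast
  then obtain V where V: "\<And>\<Omega>. finite \<Omega> \<Longrightarrow> z \<in> \<Omega> \<Longrightarrow> V \<Omega> \<in> nonneg_supported \<Omega> \<and>
      (\<forall>x\<in>\<Omega>. residual \<Omega> (V \<Omega>) x = 0) \<and> \<alpha> \<le> functional \<Omega> (V \<Omega>) \<and> functional \<Omega> (V \<Omega>) \<le> \<beta>"
    by metis
  define K where "K = \<beta> / (1 / 2 - 1 / \<theta>)"
  have \<theta>': "1 / 2 - 1 / \<theta> > 0" using \<theta> by (simp add: field_simps)
  have E_upper: "energy \<Omega> (V \<Omega>) \<le> K" and E_lower: "2 * \<alpha> \<le> energy \<Omega> (V \<Omega>)"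
    and E_eq: "energy \<Omega> (V \<Omega>) = (\<Sum>x\<in>\<Omega>. \<mu> x * (f x (V \<Omega> x) * V \<Omega> x))"
    and V_nonneg: "V \<Omega> x \<ge> 0" and V_off: "x \<notin> \<Omega> \<Longrightarrow> V \<Omega> x = 0"
    if \<Omega>: "finite \<Omega>" "z \<in> \<Omega>" for \<Omega> x
  proof -
    note v = V[OF \<Omega>]
    note b = critical_energy_bounds[OF \<Omega>(1), of "V \<Omega>"]
    have "(1 / 2 - 1 / \<theta>) * energy \<Omega> (V \<Omega>) \<le> \<beta>" using b(2) v by fastforce
    then show "energy \<Omega> (V \<Omega>) \<le> K" unfolding K_def using \<theta>' by (simp add: pos_le_divide_eq mult.commute)
    show "2 * \<alpha> \<le> energy \<Omega> (V \<Omega>)" using b(3) v by fastforce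
    show "energy \<Omega> (V \<Omega>) = (\<Sum>x\<in>\<Omega>. \<mu> x * (f x (V \<Omega> x) * V \<Omega> x))" using b(1) v by blast
    show "V \<Omega> x \<ge> 0" "x \<notin> \<Omega> \<Longrightarrow> V \<Omega> x = 0" using v by (auto simp: nonneg_supported_def)
  qed
  have K: "K > 0" using E_upper[of "{z}"] E_lower[of "{z}"] \<alpha> by simp
  have mh: "\<mu>_min * h\<^sub>0 > 0" using \<mu>_min h_lower by simp
  \<comment> \<open>Each term of the weighted square sum is at most \<open>K\<close>, which bounds
    the solutions at every vertex by \<open>M\<close>, independently of
    \<open>\<Omega>\<close>.\<close>
  define M where "M = sqrt (K / (\<mu>_min * h\<^sub>0))"
  have M: "M > 0" unfolding M_def using K mh by simp
  have V_sum: "(\<Sum>x\<in>B. \<mu> x * h x * (V \<Omega> x)\<^sup>2) \<le> K"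
    if \<Omega>: "finite \<Omega>" "z \<in> \<Omega>" and B: "B \<subseteq> \<Omega>" for \<Omega> B
  proof -
    have "(\<Sum>x\<in>B. \<mu> x * h x * (V \<Omega> x)\<^sup>2) \<le> (\<Sum>x\<in>\<Omega>. \<mu> x * h x * (V \<Omega> x)\<^sup>2)"
      using \<Omega> B \<mu>_pos h_pos by (intro sum_mono2 mult_nonneg_nonneg) (auto simp: less_imp_le)
    also have "\<dots> \<le> K" using energy_ge[OF \<Omega>(1)] E_upper[OF \<Omega>] by (rule order_trans)
    finally show ?thesis .
  qed
  have V_M: "V \<Omega> x \<le> M" if \<Omega>: "finite \<Omega>" "z \<in> \<Omega>" for \<Omega> x
  proof (cases "x \<in> \<Omega>")
    case True
    have "\<mu>_min * h\<^sub>0 * (V \<Omega> x)\<^sup>2 \<le> \<mu> x * h x * (V \<Omega> x)\<^sup>2"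
      by (intro mult_right_mono \<mu>h_ge) simp
    also have "\<dots> \<le> K" using V_sum[OF \<Omega>, of "{x}"] True by simp
    finally have "(V \<Omega> x)\<^sup>2 \<le> K / (\<mu>_min * h\<^sub>0)" using mh by (simp add: pos_le_divide_eq mult.commute)
    then show ?thesis unfolding M_def by (rule real_le_rsqrt)
  next
    case False
    then show ?thesis using V_off[OF \<Omega> False] M by simp
  qed
  obtain A' where A': "\<And>x s. s \<in> {0..M} \<Longrightarrow> f x s \<le> A'" using f_bound[OF M] by blast
  define A where "A = max 1 A'"
  have A: "A > 0" "\<And>x s. 0 \<le> s \<Longrightarrow> s \<le> M \<Longrightarrow> f x s \<le> A"
    using A' unfolding A_def by (auto simp: le_max_iff_disj)
  \<comment> \<open>\<open>\<delta>\<close> and \<open>\<epsilon>\<close> are tuned so that the two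
    parts of the tail estimate, \<open>A * \<delta> / 2 * K\<close> and
    \<open>A / (2 * \<delta>) * \<epsilon>\<close>, equal \<open>\<alpha> / 2\<close> each.\<close>
  define \<delta> where "\<delta> = \<alpha> / (A * K)"
  define \<epsilon> where "\<epsilon> = \<alpha> * \<delta> / A"
  have \<delta>\<epsilon>: "\<delta> > 0" "\<epsilon> > 0" unfolding \<delta>_def \<epsilon>_def using \<alpha> A(1) K by simp_all
  define I where "I = enn2real (\<integral>\<^sup>+x. ennreal (1 / h x) \<partial>vertex_measure \<mu>)"
  define a where "a x = \<mu> x * (1 / h x)" for x
  have a_le: "sum a B \<le> I" if "finite B" for B
    unfolding a_def I_def
  proof (rule sum_vertex_measure_le)
    show "1 / h x > 0" for x using h_pos[of x] by simp
  qed (rule h_L1 \<mu>_pos that)+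
  obtain D where D: "finite D" "D \<subseteq> ?C"
    and D_tail: "\<And>B. finite B \<Longrightarrow> B \<subseteq> ?C \<Longrightarrow> D \<inter> B = {} \<Longrightarrow> sum a B < \<epsilon>"
    using finite_tail[where a = a and I = I and \<epsilon> = \<epsilon> and C = ?C] a_le \<delta>\<epsilon>(2) by metis
  \<comment> \<open>The whole sum is the energy, hence at least \<open>2 * \<alpha>\<close>, and the
    part outside \<open>D\<close> is at most \<open>\<alpha>\<close>. What remains on
    \<open>D\<close> cannot vanish in the limit.\<close>
  have V_D: "\<alpha> \<le> (\<Sum>x\<in>D. \<mu> x * (f x (V \<Omega> x) * V \<Omega> x))"
    if \<Omega>: "finite \<Omega>" "insert z D \<subseteq> \<Omega>" "\<Omega> \<subseteq> ?C" for \<Omega>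
  proof -
    have z: "z \<in> \<Omega>" using \<Omega> by simp
    define v where "v = V \<Omega>"
    have v0: "0 \<le> v x" "v x \<le> M" for x unfolding v_def using V_nonneg V_M \<Omega>(1) z by auto
    have le_ab: "\<mu> x * (f x (v x) * v x) \<le> A * \<delta> / 2 * (\<mu> x * h x * (v x)\<^sup>2) + A / (2 * \<delta>) * a x" for x
    proof -
      \<comment> \<open>Young's inequality splits \<open>v x\<close> into a multiple of
        \<open>h x * (v x)\<^sup>2\<close>, controlled by the energy, and a multiple of
        \<open>1 / h x\<close>, controlled by integrability.\<close>
      have "0 \<le> (\<delta> * h x * v x - 1)\<^sup>2" by simp
      then have "2 * \<delta> * h x * v x \<le> (\<delta> * h x * v x)\<^sup>2 + 1"
        by (simp add: power2_diff)
      then have "v x \<le> \<delta> / 2 * (h x * (v x)\<^sup>2) + 1 / (2 * \<delta>) * (1 / h x)"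
        using \<delta>\<epsilon>(1) h_pos[of x] by (simp add: field_simps power2_eq_square)
      then have "A * \<mu> x * v x \<le> A * \<mu> x * (\<delta> / 2 * (h x * (v x)\<^sup>2) + 1 / (2 * \<delta>) * (1 / h x))"
        using A(1) \<mu>_pos[of x] by (intro mult_left_mono) auto
      moreover have "\<mu> x * (f x (v x) * v x) \<le> \<mu> x * (A * v x)"
        using A(2)[OF v0] v0(1) \<mu>_pos[of x] by (intro mult_left_mono mult_right_mono) auto
      ultimately show ?thesis unfolding a_def by (simp add: algebra_simps)
    qed
    have "(\<Sum>x\<in>\<Omega> - D. \<mu> x * (f x (v x) * v x))
        \<le> (\<Sum>x\<in>\<Omega> - D. A * \<delta> / 2 * (\<mu> x * h x * (v x)\<^sup>2) + A / (2 * \<delta>) * a x)"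
      by (intro sum_mono le_ab)
    also have "\<dots> = A * \<delta> / 2 * (\<Sum>x\<in>\<Omega> - D. \<mu> x * h x * (v x)\<^sup>2) + A / (2 * \<delta>) * sum a (\<Omega> - D)"
      by (simp only: sum.distrib sum_distrib_left)
    also have "\<dots> \<le> A * \<delta> / 2 * K + A / (2 * \<delta>) * \<epsilon>"
    proof (intro add_mono mult_left_mono)
      show "(\<Sum>x\<in>\<Omega> - D. \<mu> x * h x * (v x)\<^sup>2) \<le> K"
        unfolding v_def by (rule V_sum[OF \<Omega>(1) z]) auto
      show "sum a (\<Omega> - D) \<le> \<epsilon>"
        by (rule less_imp_le[OF D_tail]) (use \<Omega> in auto)
    qed (use A \<delta>\<epsilon> in auto)
    also have "\<dots> = \<alpha>" 
    proof -
      have "A * \<delta> / 2 * K = \<alpha> / 2" unfolding \<delta>_def using A(1) K by simp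
      moreover have "A / (2 * \<delta>) * \<epsilon> = \<alpha> / 2" unfolding \<epsilon>_def using \<delta>\<epsilon>(1) A(1) by simp
      ultimately show ?thesis by simp
    qed
    finally have tail: "(\<Sum>x\<in>\<Omega> - D. \<mu> x * (f x (v x) * v x)) \<le> \<alpha>" .
    have "(\<Sum>x\<in>\<Omega>. \<mu> x * (f x (v x) * v x))
        = (\<Sum>x\<in>\<Omega> - D. \<mu> x * (f x (v x) * v x)) + (\<Sum>x\<in>D. \<mu> x * (f x (v x) * v x))"
      using \<Omega> by (intro sum.subset_diff) auto
    then show ?thesis using tail E_lower[OF \<Omega>(1) z] E_eq[OF \<Omega>(1) z] unfolding v_def by linarith
  qed
  \<comment> \<open>Finite subsets of the component are directed by inclusion. The image filter
    lives on a compact box and so has a cluster point \<open>u\<close>, which inherits every closed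
    condition that holds for all large \<open>\<Omega>\<close>.\<close>
  define F where "F = filtermap V (finite_subsets_at_top ?C)"
  have ev: "eventually (\<lambda>u. u \<in> S) F"
    if "finite X" "X \<subseteq> ?C" "\<And>\<Omega>. finite \<Omega> \<Longrightarrow> X \<subseteq> \<Omega> \<Longrightarrow> \<Omega> \<subseteq> ?C \<Longrightarrow> V \<Omega> \<in> S" for X S
    unfolding F_def eventually_filtermap eventually_finite_subsets_at_top using that by blast
  define box where "box = {u :: 'v \<Rightarrow> real. \<forall>x. 0 \<le> u x \<and> u x \<le> M}"
  have "compact box" unfolding box_def by (rule compact_positive_box)
  moreover have "F \<noteq> bot" unfolding F_def by (simp add: filtermap_bot_iff)
  moreover have "eventually (\<lambda>u. u \<in> box) F"
    by (rule ev[of "{z}"]) (auto simp: box_def component_refl V_nonneg V_M)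
  ultimately obtain u where u: "u \<in> box" "inf (nhds u) F \<noteq> bot"
    unfolding compact_filter by blast
  have lim: "u \<in> S"
    if "closed S" "finite X" "X \<subseteq> ?C" "\<And>\<Omega>. finite \<Omega> \<Longrightarrow> X \<subseteq> \<Omega> \<Longrightarrow> \<Omega> \<subseteq> ?C \<Longrightarrow> V \<Omega> \<in> S" for X S
    using cluster_point_in_closed[OF u(2) that(1) ev[OF that(2-4)]] .
  have u0: "u x \<ge> 0" for x using u(1) by (simp add: box_def)
  \<comment> \<open>The equation at \<open>x\<close> involves only \<open>x\<close> and its finitely
    many neighbours, so it is a closed condition, and it holds for \<open>V \<Omega>\<close> as soon
    as \<open>\<Omega>\<close> contains them and \<open>z\<close>.\<close>
  have eq: "diagonal x * u x - (\<Sum>y\<in>neighbours E x. w x y * u y) = \<mu> x * f x (u x)" if x: "x \<in> ?C" for x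
  proof -
    have "u \<in> {u. diagonal x * u x - (\<Sum>y\<in>neighbours E x. w x y * u y) = \<mu> x * f x (u x)}"
    proof (rule lim[of _ "insert z (insert x (neighbours E x))"])
      show "closed {u. diagonal x * u x - (\<Sum>y\<in>neighbours E x. w x y * u y) = \<mu> x * f x (u x)}"
        by (intro closed_Collect_eq continuous_intros continuous_on_f_coord continuous_on_product_coordinates)
      show "insert z (insert x (neighbours E x)) \<subseteq> ?C"
        using x neighbours_subset_component[OF x] component_refl by auto
      fix \<Omega> assume \<Omega>: "finite \<Omega>" "insert z (insert x (neighbours E x)) \<subseteq> \<Omega>"
      then have "residual \<Omega> (V \<Omega>) x = 0" using V[of \<Omega>] by auto
      then show "V \<Omega> \<in> {u. diagonal x * u x - (\<Sum>y\<in>neighbours E x. w x y * u y) = \<mu> x * f x (u x)}"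
        using \<Omega> sum_conductance_superset[of \<Omega> x "V \<Omega>"] unfolding residual_def by simp
    qed (simp add: finite_neighbours)
    then show ?thesis by simp
  qed
  have "u \<in> {u. \<alpha> \<le> (\<Sum>x\<in>D. \<mu> x * (f x (u x) * u x))}"
  proof (rule lim[of _ "insert z D"])
    show "closed {u. \<alpha> \<le> (\<Sum>x\<in>D. \<mu> x * (f x (u x) * u x))}"
      by (intro closed_Collect_le continuous_intros continuous_on_f_coord continuous_on_product_coordinates)
  qed (use D V_D component_refl in auto)
  then have "(\<Sum>x\<in>D. \<mu> x * (f x (u x) * u x)) \<noteq> 0" using \<alpha> by auto
  then obtain x1 where x1: "x1 \<in> D" "u x1 \<noteq> 0" by (auto elim!: sum.not_neutral_contains_not_neutral)
  have pos: "u x > 0" if x: "x \<in> ?C" for x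
  proof (rule ccontr)
    assume "\<not> u x > 0"
    then have "u x = 0" using u0[of x] by simp
    \<comment> \<open>Strong maximum principle: at a zero of \<open>u\<close> the equation says that
      the weighted sum of the nonnegative neighbouring values is 0, so all neighbours are zeros.
      Along a path this reaches \<open>x1\<close>, where \<open>u\<close> is not 0.\<close>
    have "(x, x1) \<in> {(x, y). {x, y} \<in> E}\<^sup>*" using component_connected[OF x] D(2) x1(1) by blast
    then have "x1 \<in> ?C \<and> u x1 = 0"
    proof induction
      case base
      show ?case using x \<open>u x = 0\<close> by simp
    next
      case (step a b)
      have b: "b \<in> neighbours E a" using step(2) by (simp add: neighbours_def)
      have "(\<Sum>y\<in>neighbours E a. w a y * u y) = 0"
        using eq[of a] step(3) f_zero[of a] by simp
      then have "w a b * u b = 0"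
        using b finite_neighbours u0 by (subst (asm) sum_nonneg_eq_0_iff)
          (auto simp: neighbours_def w_pos less_imp_le)
      then show ?case
        using w_pos[of a b] step neighbours_subset_component[of a z] b by auto
    qed
    with x1 show False by simp
  qed
  have "- laplacian E w \<mu> u x + h x * u x = f x (u x)" if x: "x \<in> ?C" for x
  proof -
    have "(\<Sum>y\<in>neighbours E x. w x y * (u y - u x))
        = (\<Sum>y\<in>neighbours E x. w x y * u y) - (\<Sum>y\<in>neighbours E x. w x y) * u x"
      by (simp add: right_diff_distrib sum_subtractf sum_distrib_right)
    also have "\<dots> = \<mu> x * (h x * u x - f x (u x))"
      using eq[OF x] unfolding diagonal_def by (simp add: algebra_simps)
    finally show ?thesis unfolding laplacian_def using \<mu>_pos[of x] by simp
  qed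
  with pos show ?thesis by blast
qed

text \<open>The choice is indexed by the component as a set, not by the vertex. So \<open>u\<close>
  agrees with one chosen function at a vertex and at all its neighbours, which is all that the
  Laplacian there sees.\<close>

lemma positive_solution:
  "\<exists>u :: 'v \<Rightarrow> real. \<forall>x. u x > 0 \<and> - laplacian E w \<mu> u x + h x * u x = f x (u x)"
proof -
  have "\<forall>C\<in>range component. \<exists>u. \<forall>x\<in>C. u x > 0 \<and> - laplacian E w \<mu> u x + h x * u x = f x (u x)"
    using component_solution by auto
  from bchoice[OF this] obtain U where U: "\<forall>C\<in>range component. \<forall>x\<in>C.
      U C x > 0 \<and> - laplacian E w \<mu> (U C) x + h x * U C x = f x (U C x)" ..
  define u where "u x = U (component x) x" for x
  have "u x > 0 \<and> - laplacian E w \<mu> u x + h x * u x = f x (u x)" for x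
  proof -
    have "u y = U (component x) y" if "y \<in> component x" for y
      unfolding u_def component_eq[OF that] ..
    then have "laplacian E w \<mu> u x = laplacian E w \<mu> (U (component x)) x"
      unfolding laplacian_def using neighbours_subset_component[OF component_refl, of x] component_refl[of x]
      by (intro arg_cong2[where f = "(*)"] sum.cong) auto
    then show ?thesis using U component_refl[of x] unfolding u_def by auto
  qed
  then show ?thesis by blast
qed

end

theorem theorem1:
  fixes E :: "'v set set"
    and w :: "'v \<Rightarrow> 'v \<Rightarrow> real"
    and \<mu> h :: "'v \<Rightarrow> real"
    and \<mu>_min h\<^sub>0 \<theta> :: real
    and f :: "'v \<Rightarrow> real \<Rightarrow> real"
  assumes "is_graph E" and "locally_finite E"
    and w_pos: "\<And>x y. {x, y} \<in> E \<Longrightarrow> w x y > 0"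
    and w_sym: "\<And>x y. {x, y} \<in> E \<Longrightarrow> w x y = w y x"
    and \<mu>_min: "\<mu>_min > 0" "\<And>x. \<mu> x \<ge> \<mu>_min"
    and h_lower: "h\<^sub>0 > 0" "\<And>x. h x \<ge> h\<^sub>0"
    and h_L1: "integrable (vertex_measure \<mu>) (\<lambda>x. 1 / h x)"
    and f_cont: "\<And>x. continuous_on UNIV (f x)"
    and f_zero: "\<And>x. f x 0 = 0"
    and f_bound: "\<And>M. M > 0 \<Longrightarrow> \<exists>A. \<forall>x. \<forall>s\<in>{0..M}. f x s \<le> A"
    and \<theta>: "\<theta> > 2"
    and f_AR: "\<And>x s. s > 0 \<Longrightarrow>
      0 < \<theta> * primitive f x s \<and> \<theta> * primitive f x s \<le> s * f x s"
    and f_small: "\<And>x. Limsup (at_right 0) (\<lambda>s. ereal (2 * primitive f x s / s\<^sup>2))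
      < ereal (lambda1 E w \<mu> h)"
  shows "\<exists>u :: 'v \<Rightarrow> real.
    \<forall>x. u x > 0 \<and> - laplacian E w \<mu> u x + h x * u x = f x (u x)"
proof -
  interpret superlinear_problem E w \<mu> h \<mu>_min h\<^sub>0 \<theta> f
    by unfold_locales fact+
  show ?thesis by (rule positive_solution)
qed

end
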